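(* Let $n\ge 1$ and let $\mathfrak{h}_{2n+1}$ be the Heisenberg Lie algebra with basis $\{e_1,e_2,\ldots,e_{2n+1}\}$ and Lie brackets $$\mu(e_1,e_2)=e_{2n+1},\quad \mu(e_3,e_4)=e_{2n+1},\quad\ldots,\quad \mu(e_{2n-1},e_{2n})=e_{2n+1}.$$ For a diagonal derivation $$D=\mathrm{Diag}(d_1,d_{n+1}-d_1,d_2,d_{n+1}-d_2,\ldots,d_n,d_{n+1}-d_n,d_{n+1})\in\mathfrak{t}(\mathfrak{h}_{2n+1}),$$ the $3^n$ inequalities which define the cone $\mathcal{C}(\mathfrak{h}_{2n+1})$ (that is, $D\in\mathcal{C}(\mathfrak{h}_{2n+1})$ if and only if all of them hold) are $$(l+1)d_{n+1}\pm d_{i_1}\pm d_{i_2}\pm\cdots\pm d_{i_k}>0,\qquad 0\le k\le n,\quad 0\le l\le k,$$ where $1\le i_1<\cdots<i_k\le n$ ranges over all $k$-element subsets of $\{1,\ldots,n\}$, all choices of signs are taken, and $l$ is the number of minus signs chosen.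
   Context: Let $\mathfrak{n}$ be a real nilpotent Lie algebra of dimension $N$ with Lie bracket $[\cdot,\cdot]$. $\mathfrak{t}(\mathfrak{n})$ denotes a maximal abelian subspace of derivations of $\mathfrak{n}$ diagonalizable over $\mathbb{R}$ (a maximal torus). Fix a basis $\{e_1,\dots,e_N\}$ of $\mathfrak{n}$ such that $\mathfrak{t}(\mathfrak{n})\subset \mathrm{Diag}(\mathfrak{n})$, the space of operators of $\mathfrak{n}$ that are diagonal in this basis; $\mathrm{Diag}(\mathfrak{n})_{>0}$ denotes the diagonal operators with all diagonal entries positive. Put $\mathfrak{t}(\mathfrak{n})_{\mathrm{tr}>0}=\{D\in\mathfrak{t}(\mathfrak{n}):\mathrm{tr}\,D>0\}$. For $\mathfrak{h}_{2n+1}$ the basis is the one given in the claim, and $\mathfrak{t}(\mathfrak{h}_{2n+1})$ is the set of all diagonal derivations, i.e. of all $D$ of the displayed form with $d_1,\dots,d_{n+1}\in\mathbb{R}$. $\mathrm{GL}(\mathfrak{n})$ acts on $V=\Lambda^2\mathfrak{n}^*\otimes\mathfrak{n}$ by $g\cdot\mu=g\mu(g^{-1}\cdot,g^{-1}\cdot)$, with derivative $E\cdot\mu=E\mu(\cdot,\cdot)-\mu(E\cdot,\cdot)-\mu(\cdot,E\cdot)$ for $E\in\mathfrak{gl}(\mathfrak{n})$. Endow $\mathfrak{gl}(\mathfrak{n})$ and $V$ with the inner products making $\{e_i\otimes e^j\}$ and $\{(e^i\wedge e^j)\otimes e_k: i<j\}$ orthonormal. The moment map $\mathrm{m}:V\setminus\{0\}\to\mathrm{sym}(\mathfrak{n})$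 (operators symmetric with respect to the inner product making $\{e_i\}$ orthonormal) is defined by $\langle \mathrm{m}(\mu),E\rangle=\frac{1}{|\mu|^2}\langle E\cdot\mu,\mu\rangle$ for all $E\in\mathrm{sym}(\mathfrak{n})$. By convention, set $\mathrm{m}(0)=0$. Let $G_{\mathfrak{t}(\mathfrak{n})}$ be the connected component of the identity of the centralizer of $\mathfrak{t}(\mathfrak{n})$ in $\mathrm{GL}(\mathfrak{n})$. Then $$\mathcal{C}(\mathfrak{n}):=\left(\mathbb{R}_{>0}\,\mathrm{m}\left(\overline{G_{\mathfrak{t}(\mathfrak{n})}\cdot[\cdot,\cdot]}\right)\cap\mathrm{Diag}(\mathfrak{n})+\mathrm{Diag}(\mathfrak{n})_{>0}\right)\cap\mathfrak{t}(\mathfrak{n})_{\mathrm{tr}>0},$$ i.e. the set of all $D\in\mathfrak{t}(\mathfrak{n})$ with $\mathrm{tr}\,D>0$ of the form $D=r\,\mathrm{m}(\lambda)+E$ with $r>0$, $\lambda$ in the closure (in $V$) of the orbit, $\mathrm{m}(\lambda)\in\mathrm{Diag}(\mathfrak{n})$ and $E\in\mathrm{Diag}(\mathfrak{n})_{>0}$. *)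

theory Defs
  imports "HOL-Analysis.Analysis"
begin

text \<open>
  The Lie algebra \<open>\<nn>\<close> is \<open>real ^ 'i\<close> with the fixed basis \<open>e\<^sub>i = axis i 1\<close>, so \<open>N = CARD('i)\<close>; operators
  are matrices in this basis. The order on the index type serves only to pick out the basis vectors
  \<open>(e\<^sup>i \<and> e\<^sup>j) \<otimes> e\<^sub>k\<close> with \<open>i < j\<close> of \<open>V\<close>; nothing depends on which order it is.
\<close>

type_synonym 'i bracket = "real ^ 'i \<Rightarrow> real ^ 'i \<Rightarrow> real ^ 'i"

type_synonym 'i oper = "real ^ 'i ^ 'i"

definition alt_bilinear :: "'i::finite bracket set" where
  "alt_bilinear = {\<mu>. bilinear \<mu> \<and> (\<forall>x. \<mu> x x = 0)}"

definition gl_act :: "'i oper \<Rightarrow> 'i::finite bracket \<Rightarrow> 'i bracket" where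
  "gl_act g \<mu> = (\<lambda>x y. g *v \<mu> (matrix_inv g *v x) (matrix_inv g *v y))"

definition gl_deriv_act :: "'i oper \<Rightarrow> 'i::finite bracket \<Rightarrow> 'i bracket" where
  "gl_deriv_act E \<mu> = (\<lambda>x y. E *v \<mu> x y - \<mu> (E *v x) y - \<mu> x (E *v y))"

definition V_inner :: "'i::{finite,linorder} bracket \<Rightarrow> 'i bracket \<Rightarrow> real" where
  "V_inner \<mu> \<nu> = (\<Sum>(i, j) \<in> {(i, j). i < j}. \<Sum>k\<in>UNIV.
      \<mu> (axis i 1) (axis j 1) $ k * \<nu> (axis i 1) (axis j 1) $ k)"

definition sym_ops :: "'i::finite oper set" where
  "sym_ops = {A. transpose A = A}"

definition diag_ops :: "'i::finite oper set" where
  "diag_ops = {A. \<forall>i j. i \<noteq> j \<longrightarrow> A $ i $ j = 0}"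

definition pos_diag_ops :: "'i::finite oper set" where
  "pos_diag_ops = {A \<in> diag_ops. \<forall>i. A $ i $ i > 0}"

text \<open>The library inner product on matrices is the one that makes the \<open>e\<^sub>i \<otimes> e\<^sup>j\<close> orthonormal.\<close>

definition moment_map :: "'i::{finite,linorder} bracket \<Rightarrow> 'i oper" where
  "moment_map \<mu> =
     (if \<mu> = (\<lambda>x y. 0) then 0
      else THE M. M \<in> sym_ops \<and>
             (\<forall>E\<in>sym_ops. M \<bullet> E = 1 / V_inner \<mu> \<mu> * V_inner (gl_deriv_act E \<mu>) \<mu>))"

definition derivations :: "'i::finite bracket \<Rightarrow> 'i oper set" where
  "derivations \<mu> = {D. \<forall>x y. D *v \<mu> x y = \<mu> (D *v x) y + \<mu> x (D *v y)}"

definition centralizer_GL :: "'i::finite oper set \<Rightarrow> 'i oper set" where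
  "centralizer_GL T = {g. invertible g \<and> (\<forall>D\<in>T. g ** D = D ** g)}"

definition G_torus :: "'i::finite oper set \<Rightarrow> 'i oper set" where
  "G_torus T = connected_component_set (centralizer_GL T) (mat 1)"

text \<open>
  \<open>closure\<close> refers to the topology of pointwise convergence on functions. On the finite-dimensional
  space \<open>alt_bilinear\<close> it induces the usual vector space topology, so this is the closure in \<open>V\<close>.
\<close>

definition orbit_closure :: "'i::finite bracket \<Rightarrow> 'i oper set \<Rightarrow> 'i bracket set" where
  "orbit_closure \<mu> T = closure ((\<lambda>g. gl_act g \<mu>) ` G_torus T) \<inter> alt_bilinear"

definition cone_C :: "'i::{finite,linorder} bracket \<Rightarrow> 'i oper set \<Rightarrow> 'i oper set" where
  "cone_C \<mu> T =
     {D \<in> T. trace D > 0 \<and>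
        (\<exists>r > 0. \<exists>\<nu> \<in> orbit_closure \<mu> T. \<exists>E \<in> pos_diag_ops.
           moment_map \<nu> \<in> diag_ops \<and> D = r *\<^sub>R moment_map \<nu> + E)}"

text \<open>
  In what follows \<open>e\<close> enumerates the basis: the vectors \<open>e\<^sub>1, \<dots>, e\<^bsub>2n+1\<^esub>\<close> of the Heisenberg algebra are
  \<open>axis (e 1) 1, \<dots>, axis (e (2*n+1)) 1\<close>, where \<open>e\<close> maps \<open>{1..2*n+1}\<close> bijectively onto the index type.
\<close>

definition heis_bracket :: "nat \<Rightarrow> (nat \<Rightarrow> 'i) \<Rightarrow> 'i::finite bracket" where
  "heis_bracket n e = (\<lambda>x y.
     (\<Sum>i=1..n. x $ e (2*i-1) * y $ e (2*i) - x $ e (2*i) * y $ e (2*i-1)) *\<^sub>R axis (e (2*n+1)) 1)"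

definition heis_torus :: "nat \<Rightarrow> (nat \<Rightarrow> 'i) \<Rightarrow> 'i::finite oper set" where
  "heis_torus n e = diag_ops \<inter> derivations (heis_bracket n e)"

definition heis_diag_entry :: "nat \<Rightarrow> (nat \<Rightarrow> real) \<Rightarrow> nat \<Rightarrow> real" where
  "heis_diag_entry n d a =
     (if a = 2*n+1 then d (n+1)
      else if odd a then d ((a+1) div 2)
      else d (n+1) - d (a div 2))"

definition heis_diag :: "nat \<Rightarrow> (nat \<Rightarrow> 'i) \<Rightarrow> (nat \<Rightarrow> real) \<Rightarrow> 'i::finite oper" where
  "heis_diag n e d =
     (\<chi> i j. if i = j then heis_diag_entry n d (inv_into {1..2*n+1} e i) else 0)"

lemma heis_diag_mult: "(heis_diag n e d *v x) $ i = heis_diag_entry n d (inv_into {1..2*n+1} e i) * x $ i"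
proof -
  have "(\<Sum>j\<in>UNIV. (if i = j then heis_diag_entry n d (inv_into {1..2*n+1} e i) else 0) * x $ j)
     = (\<Sum>j\<in>UNIV. (if i = j then heis_diag_entry n d (inv_into {1..2*n+1} e i) * x $ j else 0))"
    by (rule sum.cong) auto
  then show ?thesis by (simp add: heis_diag_def matrix_vector_mult_def)
qed

lemma heis_torus_eq:
  fixes e :: "nat \<Rightarrow> 'i::finite"
  assumes e: "bij_betw e {1..2*n+1} UNIV"
  shows "heis_torus n e = range (heis_diag n e)"
proof (intro subset_antisym subsetI)
  have inj: "inj_on e {1..2*n+1}" and im: "e ` {1..2*n+1} = UNIV"
    using e by (auto simp: bij_betw_def)
  have inv: "inv_into {1..2*n+1} e (e a) = a" if "1 \<le> a" "a \<le> 2*n+1" for a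
    using inv_into_f_f[OF inj] that by simp
  {
    fix D assume D: "D \<in> heis_torus n e"
    then have off: "\<And>i j. i \<noteq> j \<Longrightarrow> D $ i $ j = 0"
      and der: "\<And>x y. D *v heis_bracket n e x y = heis_bracket n e (D *v x) y + heis_bracket n e x (D *v y)"
      by (auto simp: heis_torus_def diag_ops_def derivations_def)
    have mul: "(D *v x) $ i = D $ i $ i * x $ i" for x i
    proof -
      have "(\<Sum>j\<in>UNIV. D $ i $ j * x $ j) = (\<Sum>j\<in>{i}. D $ i $ j * x $ j)"
        by (rule sum.mono_neutral_right) (auto simp: off)
      then show ?thesis by (simp add: matrix_vector_mult_def)
    qed
    define a where "a k = D $ e k $ e k" for k
    have rel: "a (2*n+1) = a (2*k-1) + a (2*k)" if k: "k \<in> {1..n}" for k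
    proof -
      let ?x = "axis (e (2*k-1)) 1 :: real^'i" and ?y = "axis (e (2*k)) 1 :: real^'i"
      have neq: "e p = e q \<longleftrightarrow> p = q" if "1 \<le> p" "p \<le> 2*n+1" "1 \<le> q" "q \<le> 2*n+1" for p q
        using inj that by (auto simp: inj_on_def)
      have s: "(\<Sum>i=1..n. x $ e (2*i-1) * y $ e (2*i) - x $ e (2*i) * y $ e (2*i-1)) = x $ e (2*k-1) * y $ e (2*k)"
        if xk: "\<And>i. i \<noteq> e (2*k-1) \<Longrightarrow> x $ i = 0" and yk: "\<And>i. i \<noteq> e (2*k) \<Longrightarrow> y $ i = 0" for x y :: "real^'i"
      proof -
        have z: "x $ e (2*i) = 0" if "i \<in> {1..n}" for i
          using that k neq[of "2*i" "2*k-1"] by (intro xk) (auto, presburger)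
        have y: "y $ e (2*i) = 0" if "i \<in> {1..n}" "i \<noteq> k" for i
          using that k neq[of "2*i" "2*k"] by (intro yk) auto
        have "(\<Sum>i=1..n. x $ e (2*i-1) * y $ e (2*i) - x $ e (2*i) * y $ e (2*i-1))
          = (\<Sum>i\<in>{k}. x $ e (2*i-1) * y $ e (2*i) - x $ e (2*i) * y $ e (2*i-1))"
          by (rule sum.mono_neutral_right) (use k z y in auto)
        then show ?thesis using z[OF k] by simp
      qed
      have "(D *v heis_bracket n e ?x ?y) $ e (2*n+1)
         = (heis_bracket n e (D *v ?x) ?y + heis_bracket n e ?x (D *v ?y)) $ e (2*n+1)"
        by (simp only: der)
      moreover have "(\<Sum>i=1..n. ?x $ e (2*i-1) * ?y $ e (2*i) - ?x $ e (2*i) * ?y $ e (2*i-1)) = 1"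
        by (subst s) (auto simp: axis_def)
      moreover have "(\<Sum>i=1..n. (D *v ?x) $ e (2*i-1) * ?y $ e (2*i) - (D *v ?x) $ e (2*i) * ?y $ e (2*i-1)) = a (2*k-1)"
        by (subst s) (auto simp: axis_def mul a_def)
      moreover have "(\<Sum>i=1..n. ?x $ e (2*i-1) * (D *v ?y) $ e (2*i) - ?x $ e (2*i) * (D *v ?y) $ e (2*i-1)) = a (2*k)"
        by (subst s) (auto simp: axis_def mul a_def)
      ultimately show ?thesis
        unfolding heis_bracket_def mul by (simp add: axis_def a_def)
    qed
    define d where "d k = (if k = n+1 then a (2*n+1) else a (2*k-1))" for k
    have ent: "heis_diag_entry n d k = a k" if "k \<in> {1..2*n+1}" for k
    proof -
      consider "k = 2*n+1" | m where "k = 2*m-1" "m \<in> {1..n}" | m where "k = 2*m" "m \<in> {1..n}"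
      proof (cases "odd k")
        case True
        then obtain m where "k = 2*m+1" by (elim oddE)
        then show ?thesis using that that(2)[of "m+1"] \<open>k \<in> _\<close> by (cases "m = n") auto
      next
        case False
        then obtain m where "k = 2*m" by (auto elim: evenE)
        then show ?thesis using that(3)[of m] \<open>k \<in> _\<close> by auto
      qed
      then show ?thesis
      proof cases
        case 1 then show ?thesis by (simp add: heis_diag_entry_def d_def)
      next
        case (2 m)
        then show ?thesis by (auto simp: heis_diag_entry_def d_def)
      next
        case (3 m)
        then show ?thesis using rel[of m] by (auto simp: heis_diag_entry_def d_def)
      qed
    qed
    have "D = heis_diag n e d"
    proof -
      have "D $ i $ i = heis_diag_entry n d (inv_into {1..2*n+1} e i)" for i
      proof -
        obtain k where "k \<in> {1..2*n+1}" "i = e k" using im by blast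
        then show ?thesis using ent[of k] inv[of k] by (simp add: a_def)
      qed
      then show ?thesis by (auto simp: vec_eq_iff heis_diag_def off)
    qed
    then show "D \<in> range (heis_diag n e)" by blast
  next
    fix D assume "D \<in> range (heis_diag n e)"
    then obtain d where D: "D = heis_diag n e d" by blast
    have ent: "heis_diag_entry n d (2*n+1) = d (n+1)" "\<And>k. k \<in> {1..n} \<Longrightarrow> heis_diag_entry n d (2*k-1) = d k"
      "\<And>k. k \<in> {1..n} \<Longrightarrow> heis_diag_entry n d (2*k) = d (n+1) - d k"
      by (auto simp: heis_diag_entry_def)
    have c: "(\<Sum>i=1..n. (D *v x) $ e (2*i-1) * y $ e (2*i) - (D *v x) $ e (2*i) * y $ e (2*i-1))
      + (\<Sum>i=1..n. x $ e (2*i-1) * (D *v y) $ e (2*i) - x $ e (2*i) * (D *v y) $ e (2*i-1))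
      = d (n+1) * (\<Sum>i=1..n. x $ e (2*i-1) * y $ e (2*i) - x $ e (2*i) * y $ e (2*i-1))" for x y
      unfolding sum.distrib[symmetric] sum_distrib_left
    proof (rule sum.cong[OF refl])
      fix k assume k: "k \<in> {1..n}"
      then have "inv_into {1..2*n+1} e (e (2*k-1)) = 2*k-1" "inv_into {1..2*n+1} e (e (2*k)) = 2*k"
        by (intro inv; auto)+
      then have m: "(D *v z) $ e (2*k-1) = d k * z $ e (2*k-1)" "(D *v z) $ e (2*k) = (d (n+1) - d k) * z $ e (2*k)" for z
        using ent(2,3)[OF k] unfolding D heis_diag_mult by metis+
      show "(D *v x) $ e (2*k-1) * y $ e (2*k) - (D *v x) $ e (2*k) * y $ e (2*k-1)
       + (x $ e (2*k-1) * (D *v y) $ e (2*k) - x $ e (2*k) * (D *v y) $ e (2*k-1))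
       = d (n+1) * (x $ e (2*k-1) * y $ e (2*k) - x $ e (2*k) * y $ e (2*k-1))"
        unfolding m by (simp add: algebra_simps)
    qed
    have last: "D *v (t *\<^sub>R axis (e (2*n+1)) 1) = (d (n+1) * t) *\<^sub>R axis (e (2*n+1)) 1" for t
      unfolding vec_eq_iff D heis_diag_mult using inv[of "2*n+1"] ent(1) by (auto simp: axis_def)
    have "D \<in> derivations (heis_bracket n e)"
      unfolding derivations_def heis_bracket_def mem_Collect_eq last scaleR_add_left[symmetric] c by simp
    then show "D \<in> heis_torus n e" by (simp add: heis_torus_def D diag_ops_def heis_diag_def)
  }
qed

text \<open>
  Left-hand sides of the inequalities, as functions of \<open>d\<close>: \<open>S = {i\<^sub>1 < \<dots> < i\<^sub>k}\<close>, \<open>\<sigma>\<close> is the choice of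
  signs and \<open>l\<close> is the number of minus signs.
\<close>

definition heis_forms :: "nat \<Rightarrow> ((nat \<Rightarrow> real) \<Rightarrow> real) set" where
  "heis_forms n =
     {\<lambda>d. (real (card {i\<in>S. \<sigma> i = -1}) + 1) * d (n+1) + (\<Sum>i\<in>S. \<sigma> i * d i) | S \<sigma>.
        S \<subseteq> {1..n} \<and> \<sigma> \<in> S \<rightarrow> {-1, 1}}"

end

theory Submission
  imports Defs
begin

text \<open>
  The torus of the Heisenberg algebra contains an operator with simple spectrum, so \<open>G_torus\<close> consists
  of the positive diagonal operators. They rescale the structure constants independently, and the
  closure of the orbit consists of the brackets \<open>\<mu>(e\<^bsub>2k-1\<^esub>, e\<^bsub>2k\<^esub>) = c\<^sub>k e\<^bsub>2n+1\<^esub>\<close> with \<open>c\<^sub>k \<ge> 0\<close>. The moment map of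
  such a nonzero bracket is the convex combination, with coefficients proportional to \<open>c\<^sub>k\<^sup>2\<close>, of the weights
  \<open>F\<^sub>k = E\<^bsub>2n+1\<^esub> - E\<^bsub>2k-1\<^esub> - E\<^bsub>2k\<^esub>\<close>, where \<open>E\<^sub>i\<close> is the \<open>i\<close>-th diagonal matrix unit. So \<open>D\<close> lies in the cone iff
  there are \<open>a\<^sub>k \<ge> 0\<close> such that \<open>D - \<Sum>\<^sub>k a\<^sub>k F\<^sub>k\<close> is positive. Eliminating \<open>a\<^sub>k > max 0 (max (-d\<^sub>k) (d\<^sub>k - d\<^bsub>n+1\<^esub>))\<close>
  leaves one inequality, and expanding each maximum into its three arguments turns it into the linear ones.
\<close>

section \<open>Diagonal operators\<close>

lemma diag_ops_mult:
  assumes "A \<in> diag_ops"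
  shows "(A *v x) $ i = A $ i $ i * x $ i"
proof -
  have "(\<Sum>j\<in>UNIV. A $ i $ j * x $ j) = (\<Sum>j\<in>{i}. A $ i $ j * x $ j)"
    using assms by (intro sum.mono_neutral_right) (auto simp: diag_ops_def)
  then show ?thesis by (simp add: matrix_vector_mult_def)
qed

lemma diag_ops_subset_sym_ops: "diag_ops \<subseteq> sym_ops"
proof
  fix A :: "'i::finite oper" assume A: "A \<in> diag_ops"
  have "A $ j $ i = A $ i $ j" for i j
    using A by (cases "i = j") (auto simp: diag_ops_def)
  then show "A \<in> sym_ops" by (simp add: sym_ops_def transpose_def vec_eq_iff)
qed

lemma matrix_mult_diag_right:
  fixes A D :: "'i::finite oper"
  assumes "D \<in> diag_ops"
  shows "(A ** D) $ i $ j = A $ i $ j * D $ j $ j"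
proof -
  have "(\<Sum>k\<in>UNIV. A $ i $ k * D $ k $ j) = (\<Sum>k\<in>{j}. A $ i $ k * D $ k $ j)"
    using assms by (intro sum.mono_neutral_right) (auto simp: diag_ops_def)
  then show ?thesis by (simp add: matrix_matrix_mult_def)
qed

lemma matrix_mult_diag_left:
  fixes A D :: "'i::finite oper"
  assumes "D \<in> diag_ops"
  shows "(D ** A) $ i $ j = D $ i $ i * A $ i $ j"
proof -
  have "(\<Sum>k\<in>UNIV. D $ i $ k * A $ k $ j) = (\<Sum>k\<in>{i}. D $ i $ k * A $ k $ j)"
    using assms by (intro sum.mono_neutral_right) (auto simp: diag_ops_def)
  then show ?thesis by (simp add: matrix_matrix_mult_def)
qed

lemma mat_1_pos_diag: "(mat 1 :: 'i::finite oper) \<in> pos_diag_ops"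
  by (simp add: pos_diag_ops_def diag_ops_def mat_def)

lemma diag_ops_invertible:
  fixes A :: "'i::finite oper"
  assumes "A \<in> diag_ops" "\<And>i. A $ i $ i \<noteq> 0"
  shows "invertible A"
proof -
  let ?B = "(\<chi> i j. if i = j then inverse (A $ i $ i) else 0) :: 'i oper"
  have "A ** ?B = mat 1" "?B ** A = mat 1"
    using assms
    by (auto simp: vec_eq_iff matrix_mult_diag_left matrix_mult_diag_right mat_def diag_ops_def)
  then show ?thesis unfolding invertible_def by blast
qed

lemma diag_ops_invertible_nonzero:
  fixes A :: "'i::finite oper"
  assumes "A \<in> diag_ops" "invertible A"
  shows "A $ i $ i \<noteq> 0"
proof -
  obtain B where "A ** B = mat 1" using assms(2) unfolding invertible_def by blast
  then have "A $ i $ i * B $ i $ i = 1"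
    using matrix_mult_diag_left[OF assms(1), of B i i] by (simp add: mat_def)
  then show ?thesis by auto
qed

lemma diag_ops_matrix_inv_mult:
  fixes A :: "'i::finite oper"
  assumes "A \<in> diag_ops" "invertible A"
  shows "(matrix_inv A *v x) $ i = x $ i / A $ i $ i"
proof -
  have "A ** matrix_inv A = mat 1"
    using assms(2) unfolding invertible_def matrix_inv_def by (metis (mono_tags, lifting) someI_ex)
  then have "A *v (matrix_inv A *v x) = x"
    by (simp add: matrix_vector_mul_assoc)
  then have "A $ i $ i * (matrix_inv A *v x) $ i = x $ i"
    by (metis diag_ops_mult[OF assms(1)])
  then show ?thesis
    using diag_ops_invertible_nonzero[OF assms, of i] by (simp add: field_simps)
qed

text \<open>An operator with simple spectrum in \<open>T\<close> forces the centralizer to be diagonal; sign changes of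
  the diagonal entries then separate its components.\<close>

lemma G_torus_eq_pos_diag_ops:
  fixes T :: "'i::finite oper set"
  assumes T: "T \<subseteq> diag_ops" and D: "D \<in> T" and distinct: "\<And>i j. D $ i $ i = D $ j $ j \<Longrightarrow> i = j"
  shows "G_torus T = pos_diag_ops"
proof
  have diag: "g \<in> diag_ops" if "g \<in> centralizer_GL T" for g
  proof -
    have "g ** D = D ** g" using that D by (simp add: centralizer_GL_def)
    then have "g $ i $ j * D $ j $ j = D $ i $ i * g $ i $ j" for i j
      using matrix_mult_diag_left matrix_mult_diag_right T D by (metis subsetD)
    then show ?thesis
      using distinct by (force simp: diag_ops_def)
  qed
  show "G_torus T \<subseteq> pos_diag_ops"
  proof
    fix g assume g: "g \<in> G_torus T"
    let ?C = "connected_component_set (centralizer_GL T) (mat 1)"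
    have sub: "?C \<subseteq> centralizer_GL T" by (rule connected_component_subset)
    have "g $ i $ i > 0" for i
    proof (rule ccontr)
      assume neg: "\<not> g $ i $ i > 0"
      let ?p = "\<lambda>h :: 'i oper. h $ i $ i"
      have "connected (?p ` ?C)"
        by (intro connected_continuous_image continuous_intros) simp
      moreover have "1 \<in> ?p ` ?C"
      proof -
        \<comment> \<open>The component of a point outside the set is empty, so the existence of
          \<open>g\<close> puts \<open>mat 1\<close> into the centralizer.\<close>
        have "mat 1 \<in> centralizer_GL T"
          using connected_component_in g unfolding G_torus_def by blast
        then have "mat 1 \<in> ?C" by (simp add: connected_component_refl)
        moreover have "1 = ?p (mat 1)" by (simp add: mat_def)
        ultimately show ?thesis by (rule rev_image_eqI)
      qed
      moreover have "g $ i $ i \<in> ?p ` ?C" using g unfolding G_torus_def by blast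
      \<comment> \<open>Intermediate values: the entry is 1 at the identity and nonpositive at
        \<open>g\<close>, so it vanishes somewhere on the component, contradicting
        invertibility.\<close>
      ultimately have "0 \<in> ?p ` ?C"
        using neg by (intro connectedD_interval[of "?p ` ?C" "g $ i $ i" 1 0]) simp_all
      then obtain h where h: "h \<in> ?C" "h $ i $ i = 0" by force
      then have "h \<in> centralizer_GL T" using sub by blast
      then show False
        using h(2) diag[of h] diag_ops_invertible_nonzero[of h i] by (simp add: centralizer_GL_def)
    qed
    moreover have "g \<in> diag_ops" using g sub diag unfolding G_torus_def by blast
    ultimately show "g \<in> pos_diag_ops" by (simp add: pos_diag_ops_def)
  qed
  show "pos_diag_ops \<subseteq> G_torus T"
    unfolding G_torus_def
  proof (rule connected_component_maximal)
    show "mat 1 \<in> (pos_diag_ops :: 'i oper set)" by (rule mat_1_pos_diag)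
    \<comment> \<open>Convexity gives connectedness, which keeps all of \<open>pos_diag_ops\<close>
      in the component of \<open>mat 1\<close>.\<close>
    have "convex (pos_diag_ops :: 'i oper set)"
    proof (rule convexI)
      fix A B :: "'i oper" and u v :: real
      assume *: "A \<in> pos_diag_ops" "B \<in> pos_diag_ops" "0 \<le> u" "0 \<le> v" "u + v = 1"
      have "u * A $ i $ i + v * B $ i $ i > 0" for i
        using convexD[OF convex_real_interval(3)[of 0], of "A $ i $ i" "B $ i $ i" u v] *
        by (simp add: pos_diag_ops_def)
      then show "u *\<^sub>R A + v *\<^sub>R B \<in> pos_diag_ops"
        using * by (simp add: pos_diag_ops_def diag_ops_def)
    qed
    then show "connected (pos_diag_ops :: 'i oper set)" by (rule convex_connected)
    show "pos_diag_ops \<subseteq> centralizer_GL T"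
    proof
      fix g :: "'i oper" assume g: "g \<in> pos_diag_ops"
      then have gd: "g \<in> diag_ops" and pos: "\<And>i. g $ i $ i > 0" by (auto simp: pos_diag_ops_def)
      have "g ** D = D ** g" if "D \<in> T" for D
      proof -
        have Dd: "D \<in> diag_ops" using that T by blast
        have off: "g $ i $ j * (D $ j $ j - D $ i $ i) = 0" for i j
          using gd by (cases "i = j") (auto simp: diag_ops_def)
        show ?thesis
          unfolding vec_eq_iff matrix_mult_diag_left[OF Dd] matrix_mult_diag_right[OF Dd]
          using off by (simp add: algebra_simps)
      qed
      moreover have "invertible g"
        using diag_ops_invertible[OF gd] pos by (metis less_irrefl)
      ultimately show "g \<in> centralizer_GL T" by (simp add: centralizer_GL_def)
    qed
  qed
qed

section \<open>The linear forms\<close>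

text \<open>The values -1, 0, 1 of \<open>s\<close> record which indices occur and with which sign.
  Each minus sign takes one of the \<open>l + 1\<close> copies of \<open>d (n+1)\<close>, so the
  form splits into separate contributions of the indices.\<close>

definition sign_form :: "nat \<Rightarrow> (nat \<Rightarrow> real) \<Rightarrow> (nat \<Rightarrow> real) \<Rightarrow> real" where
  "sign_form n s d = d (n+1) + (\<Sum>i=1..n. if s i = 1 then d i else if s i = -1 then d (n+1) - d i else 0)"

lemma signed_sum_eq_sign_form:
  assumes S: "S \<subseteq> {1..n}" and \<sigma>: "\<sigma> \<in> S \<rightarrow> {-1, 1::real}"
    and s: "\<And>i. i \<in> {1..n} \<Longrightarrow> s i = (if i \<in> S then \<sigma> i else 0)"
  shows "(real (card {i\<in>S. \<sigma> i = -1}) + 1) * d (n+1) + (\<Sum>i\<in>S. \<sigma> i * d i) = sign_form n s d"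
proof -
  have fin: "finite S" using S finite_subset by blast
  have "real (card {i\<in>S. \<sigma> i = -1}) * d (n+1) = (\<Sum>i\<in>S. if \<sigma> i = -1 then d (n+1) else 0)"
    using fin by (simp add: sum.If_cases Int_def)
  then have "(real (card {i\<in>S. \<sigma> i = -1}) + 1) * d (n+1) + (\<Sum>i\<in>S. \<sigma> i * d i)
     = d (n+1) + (\<Sum>i\<in>S. (if \<sigma> i = -1 then d (n+1) else 0) + \<sigma> i * d i)"
    by (simp add: sum.distrib algebra_simps)
  also have "(\<Sum>i\<in>S. (if \<sigma> i = -1 then d (n+1) else 0) + \<sigma> i * d i)
     = (\<Sum>i\<in>S. if s i = 1 then d i else if s i = -1 then d (n+1) - d i else 0)"
    using \<sigma> S s by (intro sum.cong) (auto simp: Pi_iff subset_iff)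
  also have "\<dots> = (\<Sum>i=1..n. if s i = 1 then d i else if s i = -1 then d (n+1) - d i else 0)"
    using S s by (intro sum.mono_neutral_left) auto
  finally show ?thesis by (simp add: sign_form_def)
qed

text \<open>Pairs \<open>(S, \<sigma>)\<close> are redundant, because \<open>\<sigma>\<close> is
  arbitrary off \<open>S\<close>. Coding absent indices by 0 in extensional functions removes this
  redundancy and prepares the count.\<close>

lemma heis_forms_eq: "heis_forms n = sign_form n ` ({1..n} \<rightarrow>\<^sub>E {-1, 0, 1})"
proof (intro subset_antisym subsetI)
  fix f assume "f \<in> heis_forms n"
  then obtain S \<sigma> where f: "f = (\<lambda>d. (real (card {i\<in>S. \<sigma> i = -1}) + 1) * d (n+1) + (\<Sum>i\<in>S. \<sigma> i * d i))"
    and S: "S \<subseteq> {1..n}" and \<sigma>: "\<sigma> \<in> S \<rightarrow> {-1, 1}"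
    unfolding heis_forms_def by blast
  let ?s = "\<lambda>i\<in>{1..n}. if i \<in> S then \<sigma> i else 0"
  have "f = sign_form n ?s"
    unfolding f using signed_sum_eq_sign_form[OF S \<sigma>, of ?s] by fastforce
  moreover have "?s \<in> {1..n} \<rightarrow>\<^sub>E {-1, 0, 1}" using \<sigma> by (auto simp: Pi_iff)
  ultimately show "f \<in> sign_form n ` ({1..n} \<rightarrow>\<^sub>E {-1, 0, 1})" by blast
next
  fix f assume "f \<in> sign_form n ` ({1..n} \<rightarrow>\<^sub>E {-1, 0, 1})"
  then obtain s where f: "f = sign_form n s" and s: "s \<in> {1..n} \<rightarrow>\<^sub>E {-1, 0, 1}" by blast
  define S where "S = {i\<in>{1..n}. s i \<noteq> 0}"
  have S: "S \<subseteq> {1..n}" and \<sigma>: "s \<in> S \<rightarrow> {-1, 1}" using s by (auto simp: S_def PiE_iff)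
  have "f = (\<lambda>d. (real (card {i\<in>S. s i = -1}) + 1) * d (n+1) + (\<Sum>i\<in>S. s i * d i))"
    unfolding f using signed_sum_eq_sign_form[OF S \<sigma>, of s] by (auto simp: S_def)
  then show "f \<in> heis_forms n" unfolding heis_forms_def using S \<sigma> by blast
qed

text \<open>A sign vector is recovered from its form by evaluation at the unit vectors.\<close>

lemma inj_on_sign_form: "inj_on (sign_form n) ({1..n} \<rightarrow>\<^sub>E {-1, 0, 1})"
proof (rule inj_onI)
  fix s t assume st: "s \<in> {1..n} \<rightarrow>\<^sub>E {-1, 0, 1}" "t \<in> {1..n} \<rightarrow>\<^sub>E {-1, 0, 1}"
    and eq: "sign_form n s = sign_form n t"
  have ev: "sign_form n u (\<lambda>j. if j = i then 1 else 0) = u i"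
    if "i \<in> {1..n}" "u \<in> {1..n} \<rightarrow>\<^sub>E {-1, 0, 1}" for i u
  proof -
    let ?d = "\<lambda>j. if j = i then 1 else 0 :: real"
    \<comment> \<open>As \<open>i\<close> is at most \<open>n\<close>, \<open>?d (n+1)\<close> is 0
      and only the summand at \<open>i\<close> survives.\<close>
    have "(\<Sum>j=1..n. if u j = 1 then ?d j else if u j = -1 then ?d (n+1) - ?d j else 0)
      = (\<Sum>j\<in>{i}. if u j = 1 then ?d j else if u j = -1 then ?d (n+1) - ?d j else 0)"
      using that by (intro sum.mono_neutral_right) auto
    then show ?thesis
      using that by (auto simp: sign_form_def PiE_iff)
  qed
  show "s = t"
    using ev st eq by (intro PiE_ext[OF st]) metis
qed

lemma card_heis_forms: "card (heis_forms n) = 3 ^ n"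
proof -
  have "card (heis_forms n) = card ({1..n} \<rightarrow>\<^sub>E {-1, 0, 1::real})"
    unfolding heis_forms_eq by (rule card_image[OF inj_on_sign_form])
  also have "\<dots> = card {-1, 0, 1::real} ^ n" by (simp add: card_funcsetE)
  also have "card {-1, 0, 1::real} = 3" by simp
  finally show ?thesis .
qed

text \<open>The smallest form at \<open>d\<close> is \<open>d (n+1) + (\<Sum>i=1..n. min 0 (min (d i) (d (n+1) - d i)))\<close>.\<close>

lemma heis_forms_pos_iff:
  "(\<forall>f \<in> heis_forms n. f d > 0) \<longleftrightarrow>
   (\<exists>a. (\<forall>i\<in>{1..n}. a i \<ge> 0 \<and> d i + a i > 0 \<and> d (n+1) - d i + a i > 0) \<and> (\<Sum>i=1..n. a i) < d (n+1))"
  (is "?L \<longleftrightarrow> ?R")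
proof
  assume ?R
  then obtain a where a: "\<forall>i\<in>{1..n}. a i \<ge> 0 \<and> d i + a i > 0 \<and> d (n+1) - d i + a i > 0"
    and sum: "(\<Sum>i=1..n. a i) < d (n+1)" by blast
  show ?L
    unfolding heis_forms_eq
  proof safe
    fix s :: "nat \<Rightarrow> real"
    \<comment> \<open>Each of the three possible summands 0, \<open>d i\<close> and
      \<open>d (n+1) - d i\<close> is at least \<open>- a i\<close>.\<close>
    have "(\<Sum>i=1..n. - a i) \<le> (\<Sum>i=1..n. if s i = 1 then d i else if s i = -1 then d (n+1) - d i else 0)"
    proof (rule sum_mono)
      fix i assume "i \<in> {1..n}"
      then have "a i \<ge> 0" "d i + a i > 0" "d (n+1) - d i + a i > 0" using a by auto
      then show "- a i \<le> (if s i = 1 then d i else if s i = -1 then d (n+1) - d i else 0)" by simp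
    qed
    then show "0 < sign_form n s d" using sum by (simp add: sign_form_def sum_negf)
  qed
next
  assume L: ?L
  define m where "m i = min 0 (min (d i) (d (n+1) - d i))" for i
  \<comment> \<open>\<open>s\<close> selects at every index the term that attains the minimum
    \<open>m i\<close>.\<close>
  define s where "s = (\<lambda>i\<in>{1..n}. if m i = 0 then 0 else if m i = d i then 1 else -1 :: real)"
  have "s \<in> {1..n} \<rightarrow>\<^sub>E {-1, 0, 1}" by (auto simp: s_def)
  then have "sign_form n s d > 0" using L by (auto simp: heis_forms_eq)
  also have "sign_form n s d = d (n+1) + (\<Sum>i=1..n. m i)"
    unfolding sign_form_def by (rule arg_cong[where f="\<lambda>x. _ + x"], rule sum.cong) (auto simp: s_def m_def min_def)
  finally have \<delta>: "d (n+1) + (\<Sum>i=1..n. m i) > 0" (is "?\<delta> > 0") .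
  \<comment> \<open>The slack is cut into \<open>n + 1\<close> equal shares: \<open>n\<close> of
    them make the bounds on the \<open>a i\<close> strict, and the last keeps their sum strictly
    below \<open>d (n+1)\<close>.\<close>
  define \<epsilon> where "\<epsilon> = ?\<delta> / (real n + 1)"
  have \<epsilon>: "\<epsilon> > 0" "(real n + 1) * \<epsilon> = ?\<delta>" using \<delta> by (auto simp: \<epsilon>_def)
  have "(\<Sum>i=1..n. \<epsilon> - m i) = real n * \<epsilon> - (\<Sum>i=1..n. m i)" by (simp add: sum_subtractf)
  also have "\<dots> < d (n+1)" using \<epsilon> by (simp add: algebra_simps)
  finally have "(\<Sum>i=1..n. \<epsilon> - m i) < d (n+1)" .
  moreover have "\<epsilon> - m i \<ge> 0" "d i + (\<epsilon> - m i) > 0" "d (n+1) - d i + (\<epsilon> - m i) > 0" for i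
    using \<epsilon>(1) by (auto simp: m_def min_def)
  ultimately show ?R by (intro exI[of _ "\<lambda>i. \<epsilon> - m i"]) auto
qed

section \<open>Degenerations of the Heisenberg bracket\<close>

definition heis_form :: "nat \<Rightarrow> (nat \<Rightarrow> 'i) \<Rightarrow> (nat \<Rightarrow> real) \<Rightarrow> real ^ 'i \<Rightarrow> real ^ 'i \<Rightarrow> real" where
  "heis_form n e c x y = (\<Sum>k=1..n. c k * (x $ e (2*k-1) * y $ e (2*k) - x $ e (2*k) * y $ e (2*k-1)))"

text \<open>\<open>c\<close> lists the structure constants of the basis pairs: positive ones will
  describe the orbit, vanishing ones its degenerations.\<close>

definition heis_scaled :: "nat \<Rightarrow> (nat \<Rightarrow> 'i) \<Rightarrow> (nat \<Rightarrow> real) \<Rightarrow> 'i::finite bracket" where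
  "heis_scaled n e c = (\<lambda>x y. heis_form n e c x y *\<^sub>R axis (e (2*n+1)) 1)"

text \<open>\<open>axis p (axis p 1)\<close> is a diagonal matrix unit. The inner product with a
  diagonal operator is the eigenvalue of that operator on the basis vector of V that sends the
  \<open>k\<close>-th pair to the central direction.\<close>

definition heis_weight :: "nat \<Rightarrow> (nat \<Rightarrow> 'i) \<Rightarrow> nat \<Rightarrow> 'i::finite oper" where
  "heis_weight n e k = axis (e (2*n+1)) (axis (e (2*n+1)) 1)
     - axis (e (2*k-1)) (axis (e (2*k-1)) 1) - axis (e (2*k)) (axis (e (2*k)) 1)"

lemma heis_form_cong: "(\<And>k. k \<in> {1..n} \<Longrightarrow> c k = c' k) \<Longrightarrow> heis_form n e c = heis_form n e c'"
  by (auto simp: heis_form_def fun_eq_iff)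

lemma heis_bracket_eq_scaled: "heis_bracket n e = heis_scaled n e (\<lambda>_. 1)"
  by (simp add: heis_bracket_def heis_scaled_def heis_form_def)

lemma heis_form_add_left: "heis_form n e c (x + x') y = heis_form n e c x y + heis_form n e c x' y"
  and heis_form_add_right: "heis_form n e c x (y + y') = heis_form n e c x y + heis_form n e c x y'"
  and heis_form_scaleR_left: "heis_form n e c (t *\<^sub>R x) y = t * heis_form n e c x y"
  and heis_form_scaleR_right: "heis_form n e c x (t *\<^sub>R y) = t * heis_form n e c x y"
  by (simp_all add: heis_form_def sum_distrib_left flip: sum.distrib)
     (rule sum.cong; simp add: algebra_simps)+

lemma heis_scaled_alt_bilinear: "heis_scaled n e c \<in> alt_bilinear"
proof -
  have "heis_form n e c x x = 0" for x by (simp add: heis_form_def)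
  then show ?thesis
    by (auto simp: alt_bilinear_def heis_scaled_def bilinear_def heis_form_add_left
        heis_form_add_right heis_form_scaleR_left heis_form_scaleR_right algebra_simps intro!: linearI)
qed

section \<open>Antisymmetry of brackets and of the infinitesimal action\<close>

lemma alt_bilinear_swap:
  assumes "\<mu> \<in> alt_bilinear"
  shows "\<mu> y x = - \<mu> x y"
proof -
  have b: "bilinear \<mu>" and z: "\<And>x. \<mu> x x = 0" using assms by (auto simp: alt_bilinear_def)
  have "\<mu> (x + y) (x + y) = 0" by (rule z)
  then have "\<mu> y x + \<mu> x y = 0"
    by (simp add: bilinear_ladd[OF b] bilinear_radd[OF b] z[of x] z[of y] add.commute)
  then show ?thesis by (simp add: eq_neg_iff_add_eq_0)
qed

text \<open>Antisymmetry is what \<open>V_inner_heis_scaled\<close> asks of its first argument,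
  which is \<open>gl_deriv_act E \<nu>\<close> in the moment map computation.\<close>

lemma gl_deriv_act_swap:
  assumes "\<mu> \<in> alt_bilinear"
  shows "gl_deriv_act E \<mu> y x = - gl_deriv_act E \<mu> x y"
proof -
  have "E *v \<mu> y x = - (E *v \<mu> x y)"
    unfolding alt_bilinear_swap[OF assms, of y x] by (rule linear_neg[OF matrix_vector_mul_linear])
  then show ?thesis
    unfolding gl_deriv_act_def
    by (simp add: alt_bilinear_swap[OF assms, of "E *v y" x] alt_bilinear_swap[OF assms, of y "E *v x"])
qed

text \<open>The order on the index type decides which of \<open>(p, q)\<close> and \<open>(q, p)\<close> occurs in the sum.\<close>

lemma sum_ordered_pairs_signed:
  fixes m :: "'i::{finite,linorder} \<Rightarrow> 'i \<Rightarrow> real"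
  assumes "p \<noteq> q" "m p q = - m q p"
  shows "(\<Sum>z\<in>{(i, j). i < j}. m (fst z) (snd z) *
    ((if z = (p, q) then 1 else 0) - (if z = (q, p) then 1 else 0))) = m p q"
    (is "sum ?g ?P = _")
proof -
  have "sum ?g ?P = sum ?g {if p < q then (p, q) else (q, p)}"
    by (intro sum.mono_neutral_right) (use assms(1) in \<open>auto split: if_splits\<close>)
  then show ?thesis using assms by (simp split: if_splits)
qed

section \<open>Coordinates with respect to the enumerated basis, and the torus\<close>

context
  fixes n :: nat and e :: "nat \<Rightarrow> 'i::{finite,linorder}"
  assumes e: "bij_betw e {1..2*n+1} (UNIV :: 'i set)"
begin

lemma e_eq_iff:
  "1 \<le> p \<Longrightarrow> p \<le> 2*n+1 \<Longrightarrow> 1 \<le> q \<Longrightarrow> q \<le> 2*n+1 \<Longrightarrow> e p = e q \<longleftrightarrow> p = q"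
  using e by (auto simp: bij_betw_def inj_on_def)

lemma e_distinct [simp]:
  assumes "k \<in> {1..n}"
  shows "e (2*k-1) \<noteq> e (2*k)" "e (2*k) \<noteq> e (2*k-1)"
    "e (2*k) \<noteq> e (2*n+1)" "e (2*k-1) \<noteq> e (2*n+1)" "e (2*n+1) \<noteq> e (2*k)" "e (2*n+1) \<noteq> e (2*k-1)"
proof -
  have k: "1 \<le> k" "k \<le> n" using assms by auto
  then have "2*k-1 \<noteq> 2*k" "2*k \<noteq> 2*n+1" "2*k-1 \<noteq> 2*n+1" by presburger+
  moreover have "e (2*k-1) = e (2*k) \<longleftrightarrow> 2*k-1 = 2*k" "e (2*k) = e (2*n+1) \<longleftrightarrow> 2*k = 2*n+1"
    "e (2*k-1) = e (2*n+1) \<longleftrightarrow> 2*k-1 = 2*n+1"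
    using k by (intro e_eq_iff; linarith)+
  ultimately show "e (2*k-1) \<noteq> e (2*k)" "e (2*k) \<noteq> e (2*k-1)"
    "e (2*k) \<noteq> e (2*n+1)" "e (2*k-1) \<noteq> e (2*n+1)" "e (2*n+1) \<noteq> e (2*k)" "e (2*n+1) \<noteq> e (2*k-1)"
    by metis+
qed

lemma e_pair_eq_iff [simp]:
  assumes "j \<in> {1..n}" "k \<in> {1..n}"
  shows "e (2*j-1) = e (2*k-1) \<longleftrightarrow> j = k" "e (2*j) = e (2*k) \<longleftrightarrow> j = k"
    "e (2*j-1) \<noteq> e (2*k)" "e (2*j) \<noteq> e (2*k-1)"
proof -
  have jk: "1 \<le> j" "j \<le> n" "1 \<le> k" "k \<le> n" using assms by auto
  then have "2*j-1 \<noteq> 2*k" "2*j \<noteq> 2*k-1" "2*j-1 = 2*k-1 \<longleftrightarrow> j = k" by presburger+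
  moreover have "e (2*j-1) = e (2*k-1) \<longleftrightarrow> 2*j-1 = 2*k-1" "e (2*j) = e (2*k) \<longleftrightarrow> 2*j = 2*k"
    "e (2*j-1) = e (2*k) \<longleftrightarrow> 2*j-1 = 2*k" "e (2*j) = e (2*k-1) \<longleftrightarrow> 2*j = 2*k-1"
    using jk by (intro e_eq_iff; linarith)+
  ultimately show "e (2*j-1) = e (2*k-1) \<longleftrightarrow> j = k" "e (2*j) = e (2*k) \<longleftrightarrow> j = k"
    "e (2*j-1) \<noteq> e (2*k)" "e (2*j) \<noteq> e (2*k-1)"
    by simp_all
qed

lemma basis_cases:
  obtains "i = e (2*n+1)" | k where "k \<in> {1..n}" "i = e (2*k-1)" | k where "k \<in> {1..n}" "i = e (2*k)"
proof -
  have "i \<in> e ` {1..2*n+1}" using e by (simp add: bij_betw_def)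
  then obtain p where p: "p \<in> {1..2*n+1}" "i = e p" by blast
  show thesis
  proof (cases "odd p")
    case True
    then obtain m where "p = 2*m+1" by (elim oddE)
    \<comment> \<open>For \<open>p = 2*m+1\<close>, the case \<open>m = n\<close> is the central
      vector; otherwise \<open>p = 2*k-1\<close> with \<open>k = m+1\<close>.\<close>
    then show ?thesis using that(1) that(2)[of "m+1"] p by (cases "m = n") auto
  next
    case False
    then obtain m where "p = 2*m" by (auto elim: evenE)
    then show ?thesis using that(3)[of m] p by auto
  qed
qed

lemma heis_diag_nth:
  shows "heis_diag n e d $ e (2*n+1) $ e (2*n+1) = d (n+1)"
    and "k \<in> {1..n} \<Longrightarrow> heis_diag n e d $ e (2*k-1) $ e (2*k-1) = d k"
    and "k \<in> {1..n} \<Longrightarrow> heis_diag n e d $ e (2*k) $ e (2*k) = d (n+1) - d k"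
proof -
  have inv: "inv_into {1..2*n+1} e (e a) = a" if "a \<in> {1..2*n+1}" for a
    using inv_into_f_f[of e "{1..2*n+1}" a] e that by (simp add: bij_betw_def)
  have nth: "heis_diag n e d $ e a $ e a = heis_diag_entry n d a" if "a \<in> {1..2*n+1}" for a
    using inv[OF that] by (simp add: heis_diag_def)
  show "heis_diag n e d $ e (2*n+1) $ e (2*n+1) = d (n+1)"
    by (subst nth) (auto simp: heis_diag_entry_def)
  show "heis_diag n e d $ e (2*k-1) $ e (2*k-1) = d k" if "k \<in> {1..n}"
    using that by (subst nth) (auto simp: heis_diag_entry_def)
  show "heis_diag n e d $ e (2*k) $ e (2*k) = d (n+1) - d k" if "k \<in> {1..n}"
    using that by (subst nth) (auto simp: heis_diag_entry_def)
qed

lemma heis_torus_diag: "heis_torus n e \<subseteq> diag_ops"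
  by (simp add: heis_torus_def)

lemma heis_diag_in_torus: "heis_diag n e d \<in> heis_torus n e"
  by (simp add: heis_torus_eq[OF e])

text \<open>The two entries of each pair add up to \<open>d (n+1)\<close>, and the centre
  contributes one more copy. Positivity of the trace thus reduces to
  \<open>d (n+1) > 0\<close>.\<close>

lemma trace_heis_diag: "trace (heis_diag n e d) = real (n+1) * d (n+1)"
proof -
  have inv: "inv_into {1..2*n+1} e (e a) = a" if "a \<in> {1..2*n+1}" for a
    using inv_into_f_f[of e "{1..2*n+1}" a] e that by (simp add: bij_betw_def)
  have "trace (heis_diag n e d) = (\<Sum>a\<in>{1..2*n+1}. heis_diag_entry n d a)"
    unfolding trace_def heis_diag_def
    by (subst sum.reindex_bij_betw[OF e, symmetric]) (use inv in \<open>simp del: atLeastAtMost_iff\<close>)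
  also have "\<dots> = (\<Sum>a\<in>{1..2*n}. heis_diag_entry n d a) + d (n+1)"
    by (simp add: heis_diag_entry_def)
  also have "(\<Sum>a\<in>{1..2*n}. heis_diag_entry n d a)
     = (\<Sum>a\<in>{1..2*n}. if odd a then d ((a+1) div 2) else d (n+1) - d (a div 2))"
    by (rule sum.cong) (auto simp: heis_diag_entry_def)
  also have "\<dots> = real n * d (n+1)"
  proof -
    \<comment> \<open>The number \<open>m\<close> of pairs is decoupled from \<open>n\<close>, so
      that \<open>d (n+1)\<close> stays fixed during the induction.\<close>
    have "(\<Sum>a\<in>{1..2*m}. if odd a then d ((a+1) div 2) else d (n+1) - d (a div 2)) = real m * d (n+1)" for m
      by (induction m) (auto simp: algebra_simps)
    then show ?thesis .
  qed
  finally show ?thesis by (simp add: algebra_simps)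
qed

lemma G_torus_heis: "G_torus (heis_torus n e) = pos_diag_ops"
proof (rule G_torus_eq_pos_diag_ops[OF heis_torus_diag heis_diag_in_torus])
  \<comment> \<open>A simple spectrum: the odd positions below the centre get 1 to \<open>n\<close>,
    the even ones \<open>n + 2\<close> to \<open>2 * n + 1\<close>, and the centre
    \<open>2 * n + 2\<close>.\<close>
  let ?d = "\<lambda>k. if k = n+1 then 2 * real n + 2 else real k"
  have nth: "heis_diag n e ?d $ e (2*n+1) $ e (2*n+1) = 2 * real n + 2"
    "k \<in> {1..n} \<Longrightarrow> heis_diag n e ?d $ e (2*k-1) $ e (2*k-1) = real k"
    "k \<in> {1..n} \<Longrightarrow> heis_diag n e ?d $ e (2*k) $ e (2*k) = 2 * real n + 2 - real k" for k
    by (simp_all only: heis_diag_nth) auto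
  fix i j assume "heis_diag n e ?d $ i $ i = heis_diag n e ?d $ j $ j"
  then show "i = j"
    by (cases i rule: basis_cases; cases j rule: basis_cases) (auto simp only: nth, auto)
qed

section \<open>Inner products with scaled brackets and the moment map\<close>

lemma heis_form_axis_right:
  assumes "k \<in> {1..n}"
  shows "heis_form n e c x (axis (e (2*k)) 1) = c k * x $ e (2*k-1)"
proof -
  have "heis_form n e c x (axis (e (2*k)) 1)
    = (\<Sum>j\<in>{k}. c j * (x $ e (2*j-1) * axis (e (2*k)) 1 $ e (2*j) - x $ e (2*j) * axis (e (2*k)) 1 $ e (2*j-1)))"
    unfolding heis_form_def using assms
    by (intro sum.mono_neutral_right) (auto simp: axis_def simp del: One_nat_def)
  then show ?thesis using assms by (auto simp: axis_def simp del: One_nat_def)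
qed

text \<open>One argument stays arbitrary because \<open>gl_deriv_act\<close> inserts
  \<open>E *v y\<close> there.\<close>

lemma heis_form_axis_left:
  assumes "k \<in> {1..n}"
  shows "heis_form n e c (axis (e (2*k-1)) 1) y = c k * y $ e (2*k)"
proof -
  have "heis_form n e c (axis (e (2*k-1)) 1) y
    = (\<Sum>j\<in>{k}. c j * (axis (e (2*k-1)) 1 $ e (2*j-1) * y $ e (2*j) - axis (e (2*k-1)) 1 $ e (2*j) * y $ e (2*j-1)))"
    unfolding heis_form_def using assms
    by (intro sum.mono_neutral_right) (auto simp: axis_def simp del: One_nat_def)
  then show ?thesis using assms by (auto simp: axis_def simp del: One_nat_def)
qed

lemma heis_form_axis:
  "k \<in> {1..n} \<Longrightarrow> heis_form n e c (axis (e (2*k-1)) 1) (axis (e (2*k)) 1) = c k"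
  by (simp only: heis_form_axis_left) simp

text \<open>The scaled bracket lives on the basis pairs and in the central component, so only those
  structure constants of \<open>\<mu>\<close> are seen. Antisymmetry makes the result independent of
  how the order orients each pair.\<close>

lemma V_inner_heis_scaled:
  assumes "\<And>x y. \<mu> y x = - \<mu> x y"
  shows "V_inner \<mu> (heis_scaled n e c)
    = (\<Sum>k=1..n. c k * \<mu> (axis (e (2*k-1)) 1) (axis (e (2*k)) 1) $ e (2*n+1))"
proof -
  let ?P = "{(i, j). i < j} :: ('i \<times> 'i) set"
  let ?m = "\<lambda>i j. \<mu> (axis i 1) (axis j 1) $ e (2*n+1)"
  \<comment> \<open>The value of the 2-form dual to the \<open>k\<close>-th pair on two basis
    vectors.\<close>
  let ?\<delta> = "\<lambda>k z. (if z = (e (2*k-1), e (2*k)) then 1 else 0)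
     - (if z = (e (2*k), e (2*k-1)) then 1 else 0) :: real"
  have "(\<Sum>k\<in>UNIV. \<mu> (axis i 1) (axis j 1) $ k * heis_scaled n e c (axis i 1) (axis j 1) $ k)
     = ?m i j * (\<Sum>k=1..n. c k * ?\<delta> k (i, j))" for i j
  proof -
    have "(\<Sum>k\<in>UNIV. \<mu> (axis i 1) (axis j 1) $ k * heis_scaled n e c (axis i 1) (axis j 1) $ k)
       = \<mu> (axis i 1) (axis j 1) \<bullet> heis_scaled n e c (axis i 1) (axis j 1)"
      by (simp add: inner_vec_def)
    also have "\<dots> = ?m i j * heis_form n e c (axis i 1) (axis j 1)"
      by (simp add: heis_scaled_def inner_axis)
    also have "heis_form n e c (axis i 1) (axis j 1) = (\<Sum>k=1..n. c k * ?\<delta> k (i, j))"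
    proof -
      have "axis i 1 $ p * axis j 1 $ q = (if (i, j) = (p, q) then 1 else 0 :: real)" for p q
        by (auto simp: axis_def)
      then show ?thesis by (simp only: heis_form_def)
    qed
    finally show ?thesis .
  qed
  then have "V_inner \<mu> (heis_scaled n e c) = (\<Sum>(i, j)\<in>?P. ?m i j * (\<Sum>k=1..n. c k * ?\<delta> k (i, j)))"
    unfolding V_inner_def by simp
  also have "\<dots> = (\<Sum>k=1..n. c k * (\<Sum>z\<in>?P. ?m (fst z) (snd z) * ?\<delta> k z))"
  proof -
    have "(\<Sum>(i, j)\<in>?P. ?m i j * (\<Sum>k=1..n. c k * ?\<delta> k (i, j)))
      = (\<Sum>z\<in>?P. \<Sum>k=1..n. c k * (?m (fst z) (snd z) * ?\<delta> k z))"
      by (rule sum.cong) (simp_all only: split_def sum_distrib_left mult.left_commute prod.collapse)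
    also have "\<dots> = (\<Sum>k=1..n. \<Sum>z\<in>?P. c k * (?m (fst z) (snd z) * ?\<delta> k z))" by (rule sum.swap)
    finally show ?thesis by (simp only: sum_distrib_left)
  qed
  also have "\<dots> = (\<Sum>k=1..n. c k * ?m (e (2*k-1)) (e (2*k)))"
  proof (rule sum.cong[OF refl])
    fix k assume k: "k \<in> {1..n}"
    have "(\<Sum>z\<in>?P. ?m (fst z) (snd z) * ?\<delta> k z) = ?m (e (2*k-1)) (e (2*k))"
      using e_distinct(1)[OF k] assms[of "axis (e (2*k)) 1" "axis (e (2*k-1)) 1"]
      by (intro sum_ordered_pairs_signed) simp_all
    then show "c k * (\<Sum>z\<in>?P. ?m (fst z) (snd z) * ?\<delta> k z) = c k * ?m (e (2*k-1)) (e (2*k))"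
      by simp
  qed
  finally show ?thesis .
qed

lemma heis_weight_inner:
  "heis_weight n e k \<bullet> E = E $ e (2*n+1) $ e (2*n+1) - E $ e (2*k-1) $ e (2*k-1) - E $ e (2*k) $ e (2*k)"
  by (simp add: heis_weight_def inner_diff_left inner_axis')

lemma heis_weight_diag: "heis_weight n e k \<in> diag_ops"
  by (auto simp: heis_weight_def diag_ops_def axis_def)

text \<open>Paired with the bracket, its derivative along \<open>E\<close> involves only diagonal
  entries of \<open>E\<close>, in the combination given by the weights. The functional is therefore
  represented by their mean with masses \<open>(c k)\<^sup>2\<close>.\<close>

lemma moment_map_heis_scaled:
  "moment_map (heis_scaled n e c)
     = (1 / (\<Sum>k=1..n. (c k)\<^sup>2)) *\<^sub>R (\<Sum>k=1..n. (c k)\<^sup>2 *\<^sub>R heis_weight n e k)"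
  (is "_ = ?M")
proof (cases "\<forall>k\<in>{1..n}. c k = 0")
  case True
  \<comment> \<open>For the zero bracket the right-hand side is 0 too, in accordance with the
    convention for the moment map.\<close>
  then have "heis_scaled n e c = (\<lambda>x y. 0)" by (auto simp: heis_scaled_def heis_form_def)
  then show ?thesis using True by (simp add: moment_map_def)
next
  case False
  let ?\<nu> = "heis_scaled n e c"
  have nz: "?\<nu> \<noteq> (\<lambda>x y. 0)"
  proof
    assume z: "?\<nu> = (\<lambda>x y. 0)"
    have "c k = 0" if "k \<in> {1..n}" for k
    proof -
      have "?\<nu> (axis (e (2*k-1)) 1) (axis (e (2*k)) 1) = 0" by (simp add: z)
      then show ?thesis unfolding heis_scaled_def heis_form_axis[OF that] by (simp add: axis_eq_0_iff)
    qed
    then show False using False by blast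
  qed
  have alt: "?\<nu> \<in> alt_bilinear" by (rule heis_scaled_alt_bilinear)
  have norm: "V_inner ?\<nu> ?\<nu> = (\<Sum>k=1..n. (c k)\<^sup>2)"
    unfolding V_inner_heis_scaled[OF alt_bilinear_swap[OF alt]]
    by (rule sum.cong) (simp_all add: heis_scaled_def heis_form_axis power2_eq_square del: One_nat_def)
  have deriv: "V_inner (gl_deriv_act E ?\<nu>) ?\<nu> = (\<Sum>k=1..n. (c k)\<^sup>2 *\<^sub>R heis_weight n e k) \<bullet> E" for E
    unfolding V_inner_heis_scaled[OF gl_deriv_act_swap[OF alt]] inner_sum_left
  proof (rule sum.cong[OF refl])
    fix k assume k: "k \<in> {1..n}"
    have col: "(E *v axis i 1) $ j = E $ j $ i" for i j
      by (simp add: matrix_vector_mult_basis column_def)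
    show "c k * gl_deriv_act E ?\<nu> (axis (e (2*k-1)) 1) (axis (e (2*k)) 1) $ e (2*n+1)
      = (c k)\<^sup>2 *\<^sub>R heis_weight n e k \<bullet> E"
      unfolding gl_deriv_act_def heis_scaled_def heis_form_axis[OF k]
        heis_form_axis_left[OF k] heis_form_axis_right[OF k]
      by (simp add: col heis_weight_inner matrix_vector_mult_scaleR power2_eq_square algebra_simps)
  qed
  have M: "?M \<in> sym_ops"
  proof -
    have "?M \<in> diag_ops"
      using heis_weight_diag by (auto simp: diag_ops_def sum_component)
    then show ?thesis using diag_ops_subset_sym_ops by blast
  qed
  have "moment_map ?\<nu> = (THE M. M \<in> sym_ops \<and>
      (\<forall>E\<in>sym_ops. M \<bullet> E = 1 / V_inner ?\<nu> ?\<nu> * V_inner (gl_deriv_act E ?\<nu>) ?\<nu>))"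
    using nz by (simp add: moment_map_def)
  also have "\<dots> = ?M"
  proof (rule the_equality)
    show "?M \<in> sym_ops \<and> (\<forall>E\<in>sym_ops. ?M \<bullet> E = 1 / V_inner ?\<nu> ?\<nu> * V_inner (gl_deriv_act E ?\<nu>) ?\<nu>)"
      using M by (simp add: norm deriv)
    fix M' assume M': "M' \<in> sym_ops \<and> (\<forall>E\<in>sym_ops. M' \<bullet> E = 1 / V_inner ?\<nu> ?\<nu> * V_inner (gl_deriv_act E ?\<nu>) ?\<nu>)"
    \<comment> \<open>The difference of two solutions is symmetric, hence a legitimate test operator
      orthogonal to itself.\<close>
    then have "(M' - ?M) \<bullet> E = 0" if "E \<in> sym_ops" for E
      using that by (simp add: norm deriv inner_diff_left)
    moreover have "M' - ?M \<in> sym_ops"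
      using M M' by (simp add: sym_ops_def transpose_def vec_eq_iff)
    ultimately have "(M' - ?M) \<bullet> (M' - ?M) = 0" by blast
    then show "M' = ?M" by simp
  qed
  finally show ?thesis .
qed

text \<open>The matrix units of a pair occur in one weight only, the central one in all of them.
  Comparing these entries with those of \<open>heis_diag\<close> yields the inequalities for
  \<open>a\<close>.\<close>

lemma heis_weight_sum_nth:
  fixes a :: "nat \<Rightarrow> real"
  defines "W \<equiv> (\<Sum>k=1..n. a k *\<^sub>R heis_weight n e k)"
  shows "W $ e (2*n+1) $ e (2*n+1) = (\<Sum>k=1..n. a k)"
    and "k \<in> {1..n} \<Longrightarrow> W $ e (2*k-1) $ e (2*k-1) = - a k"
    and "k \<in> {1..n} \<Longrightarrow> W $ e (2*k) $ e (2*k) = - a k"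
    and "W \<in> diag_ops"
proof -
  have unit: "axis p (axis p 1) $ i $ i = (if i = p then 1 else 0 :: real)" for p i :: 'i
    by (simp add: axis_def)
  have W: "W $ i $ i = (\<Sum>k=1..n. a k * ((if i = e (2*n+1) then 1 else 0)
      - (if i = e (2*k-1) then 1 else 0) - (if i = e (2*k) then 1 else 0)))" for i
    by (simp add: W_def sum_component heis_weight_def unit)
  show "W $ e (2*n+1) $ e (2*n+1) = (\<Sum>k=1..n. a k)"
    unfolding W by (rule sum.cong) (simp_all only: e_distinct if_False if_True, simp)
  show "W $ e (2*k-1) $ e (2*k-1) = - a k" if k: "k \<in> {1..n}"
  proof -
    have "W $ e (2*k-1) $ e (2*k-1) = (\<Sum>j=1..n. if k = j then - a j else 0)"
      unfolding W by (rule sum.cong) (simp_all only: e_distinct[OF k] e_pair_eq_iff[OF k] if_False if_True, simp)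
    then show ?thesis using k by simp
  qed
  show "W $ e (2*k) $ e (2*k) = - a k" if k: "k \<in> {1..n}"
  proof -
    have "W $ e (2*k) $ e (2*k) = (\<Sum>j=1..n. if k = j then - a j else 0)"
      unfolding W by (rule sum.cong) (simp_all only: e_distinct[OF k] e_pair_eq_iff[OF k] if_False if_True, simp)
    then show ?thesis using k by simp
  qed
  show "W \<in> diag_ops"
    using heis_weight_diag by (auto simp: W_def diag_ops_def sum_component)
qed

section \<open>The orbit of the Heisenberg bracket and its closure\<close>

lemma gl_act_heis_bracket:
  assumes "g \<in> diag_ops" "invertible g"
  shows "gl_act g (heis_bracket n e)
    = heis_scaled n e (\<lambda>k. g $ e (2*n+1) $ e (2*n+1) / (g $ e (2*k-1) $ e (2*k-1) * g $ e (2*k) $ e (2*k)))"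
proof -
  let ?l = "e (2*n+1)"
  have "g *v (t *\<^sub>R axis l 1) = (t * g $ l $ l) *\<^sub>R axis l 1" for t l
    by (auto simp: vec_eq_iff diag_ops_mult[OF assms(1)] axis_def)
  moreover have "heis_form n e (\<lambda>_. 1) (matrix_inv g *v x) (matrix_inv g *v y) * g $ ?l $ ?l
    = heis_form n e (\<lambda>k. g $ ?l $ ?l / (g $ e (2*k-1) $ e (2*k-1) * g $ e (2*k) $ e (2*k))) x y" for x y
    unfolding heis_form_def diag_ops_matrix_inv_mult[OF assms] sum_distrib_right
    by (rule sum.cong) (simp_all add: divide_inverse algebra_simps)
  ultimately show ?thesis
    by (simp only: gl_act_def heis_bracket_eq_scaled heis_scaled_def)
qed

lemma orbit_heis:
  "(\<lambda>g. gl_act g (heis_bracket n e)) ` G_torus (heis_torus n e)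
     = {heis_scaled n e c | c. \<forall>k\<in>{1..n}. c k > 0}"
  unfolding G_torus_heis
proof (intro subset_antisym subsetI)
  fix \<nu> assume "\<nu> \<in> (\<lambda>g. gl_act g (heis_bracket n e)) ` pos_diag_ops"
  then obtain g where \<nu>: "\<nu> = gl_act g (heis_bracket n e)" and g: "g \<in> diag_ops" "\<And>i. g $ i $ i > 0"
    by (auto simp: pos_diag_ops_def)
  have "invertible g" using diag_ops_invertible[OF g(1)] g(2) by (metis less_irrefl)
  then show "\<nu> \<in> {heis_scaled n e c | c. \<forall>k\<in>{1..n}. c k > 0}"
    unfolding \<nu> gl_act_heis_bracket[OF g(1) \<open>invertible g\<close>] using g(2) by fastforce
next
  fix \<nu> assume "\<nu> \<in> {heis_scaled n e c | c. \<forall>k\<in>{1..n}. c k > 0}"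
  then obtain c where \<nu>: "\<nu> = heis_scaled n e c" and c: "\<And>k. k \<in> {1..n} \<Longrightarrow> c k > 0" by blast
  \<comment> \<open>\<open>g\<close> is the identity except for the entry \<open>1 / c k\<close> at
    \<open>e (2*k)\<close>, which turns the \<open>k\<close>-th structure constant into
    \<open>c k\<close>. The choice operator recovers \<open>k\<close> from the basis index.\<close>
  define g :: "'i oper" where "g = (\<chi> i j. if i = j then
     (if \<exists>k\<in>{1..n}. i = e (2*k) then 1 / c (SOME k. k \<in> {1..n} \<and> i = e (2*k)) else 1) else 0)"
  have some: "(SOME j. j \<in> {1..n} \<and> e (2*k) = e (2*j)) = k" if "k \<in> {1..n}" for k
    using that by (intro some_equality) auto
  have g_nth: "g $ e (2*k) $ e (2*k) = 1 / c k" "g $ e (2*k-1) $ e (2*k-1) = 1" if "k \<in> {1..n}" for k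
    using that some[OF that] e_pair_eq_iff(3)[OF that] unfolding g_def by (auto simp del: One_nat_def)
  have g_last: "g $ e (2*n+1) $ e (2*n+1) = 1"
    using e_distinct(5) unfolding g_def by auto
  have gd: "g \<in> diag_ops" by (simp add: g_def diag_ops_def)
  have pos: "g $ i $ i > 0" for i
    by (cases i rule: basis_cases) (use g_nth g_last c in \<open>simp_all del: One_nat_def\<close>)
  have "invertible g" using diag_ops_invertible[OF gd] pos by (metis less_irrefl)
  then have "gl_act g (heis_bracket n e) = \<nu>"
    unfolding gl_act_heis_bracket[OF gd \<open>invertible g\<close>] \<nu> heis_scaled_def
    by (subst heis_form_cong[of n _ c]) (use g_nth g_last in \<open>simp_all del: One_nat_def\<close>)
  then show "\<nu> \<in> (\<lambda>g. gl_act g (heis_bracket n e)) ` pos_diag_ops"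
    using gd pos by (auto simp: pos_diag_ops_def)
qed

lemma orbit_closure_heis:
  "orbit_closure (heis_bracket n e) (heis_torus n e) = {heis_scaled n e c | c. \<forall>k\<in>{1..n}. c k \<ge> 0}"
proof (intro subset_antisym subsetI)
  let ?O = "{heis_scaled n e c | c. \<forall>k\<in>{1..n}. c k > 0}"
  let ?c = "\<lambda>\<nu> k. \<nu> (axis (e (2*k-1)) 1) (axis (e (2*k)) 1) $ e (2*n+1)"
  \<comment> \<open>\<open>?K\<close> says that \<open>\<nu>\<close> is rebuilt from its own
    structure constants \<open>?c \<nu>\<close> and that these are nonnegative. Such equations and
    weak inequalities between coordinates survive pointwise limits.\<close>
  let ?K = "{\<nu> :: 'i bracket. (\<forall>x y. \<nu> x y = heis_scaled n e (?c \<nu>) x y) \<and> (\<forall>k. k \<in> {1..n} \<longrightarrow> ?c \<nu> k \<ge> 0)}"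
  have cont: "continuous_on UNIV (\<lambda>\<nu> :: 'i bracket. \<nu> x y)" for x y
    by (rule continuous_on_product_then_coordinatewise[OF continuous_on_product_coordinates])
  have "closed ?K"
    unfolding heis_scaled_def heis_form_def
    by (intro closed_Collect_conj closed_Collect_all closed_Collect_imp closed_Collect_eq closed_Collect_le
        continuous_intros cont) auto
  have "?O \<subseteq> ?K"
  proof
    fix \<nu> assume "\<nu> \<in> ?O"
    then obtain c where \<nu>: "\<nu> = heis_scaled n e c" and c: "\<And>k. k \<in> {1..n} \<Longrightarrow> c k > 0" by blast
    have ck: "?c \<nu> k = c k" if "k \<in> {1..n}" for k
      unfolding \<nu> heis_scaled_def heis_form_axis[OF that] by simp
    have "heis_form n e (?c \<nu>) = heis_form n e c" by (rule heis_form_cong[OF ck])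
    then have "\<nu> = heis_scaled n e (?c \<nu>)" by (simp only: \<nu> heis_scaled_def)
    then show "\<nu> \<in> ?K" using c ck by (auto simp: less_imp_le dest: fun_cong)
  qed
  then have sub: "closure ?O \<subseteq> ?K" using \<open>closed ?K\<close> by (rule closure_minimal)
  {
    fix \<nu> assume "\<nu> \<in> orbit_closure (heis_bracket n e) (heis_torus n e)"
    then have "\<nu> \<in> ?K" using sub unfolding orbit_closure_def orbit_heis by blast
    then have "\<nu> = heis_scaled n e (?c \<nu>)" "\<forall>k\<in>{1..n}. ?c \<nu> k \<ge> 0" by blast+
    then show "\<nu> \<in> {heis_scaled n e c | c. \<forall>k\<in>{1..n}. c k \<ge> 0}" by blast
  next
    fix \<nu> assume "\<nu> \<in> {heis_scaled n e c | c. \<forall>k\<in>{1..n}. c k \<ge> 0}"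
    then obtain c where \<nu>: "\<nu> = heis_scaled n e c" and c: "\<forall>k\<in>{1..n}. c k \<ge> 0" by blast
    \<comment> \<open>Adding \<open>t > 0\<close> to all constants gives a path inside the orbit
      that tends to \<open>\<nu>\<close> as \<open>t\<close> goes to 0.\<close>
    let ?f = "\<lambda>t. heis_scaled n e (\<lambda>k. c k + t)"
    have "continuous_on (closure {0<..}) (\<lambda>t. ?f t x y)" for x y
      unfolding heis_scaled_def heis_form_def by (intro continuous_intros)
    then have "continuous_on (closure {0<..}) ?f"
      by (rule continuous_on_coordinatewise_then_product[OF continuous_on_coordinatewise_then_product])
    moreover have "?f ` {0<..} \<subseteq> closure ?O"
      using c by (intro order_trans[OF _ closure_subset]) (auto intro!: add_nonneg_pos)
    ultimately have "?f ` closure {0<..} \<subseteq> closure ?O"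
      by (rule image_closure_subset[OF _ closed_closure])
    then have "?f 0 \<in> closure ?O" by (rule subsetD) (rule imageI, simp)
    then show "\<nu> \<in> orbit_closure (heis_bracket n e) (heis_torus n e)"
      unfolding orbit_closure_def orbit_heis using heis_scaled_alt_bilinear by (simp add: \<nu>)
  }
qed

section \<open>Membership in the cone as solvability in the weight coefficients\<close>

lemma heis_diag_in_cone_iff:
  "heis_diag n e d \<in> cone_C (heis_bracket n e) (heis_torus n e) \<longleftrightarrow>
   (\<exists>a. (\<forall>i\<in>{1..n}. a i \<ge> 0 \<and> d i + a i > 0 \<and> d (n+1) - d i + a i > 0) \<and> (\<Sum>i=1..n. a i) < d (n+1))"
  (is "?L \<longleftrightarrow> ?R")
proof
  assume ?L
  then obtain r c E where r: "r > 0" and E: "E \<in> pos_diag_ops"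
    and D: "heis_diag n e d = r *\<^sub>R moment_map (heis_scaled n e c) + E"
    by (auto simp: cone_C_def orbit_closure_heis)
  \<comment> \<open>\<open>r\<close> and the normalization of the moment map are absorbed into the
    coefficients. If all \<open>c k\<close> with \<open>k\<close> in \<open>{1..n}\<close> vanish,
    division by zero gives \<open>a k = 0\<close>, as it should.\<close>
  define a where "a k = r / (\<Sum>k=1..n. (c k)\<^sup>2) * (c k)\<^sup>2" for k
  let ?W = "\<Sum>k=1..n. a k *\<^sub>R heis_weight n e k"
  have "heis_diag n e d = ?W + E"
    unfolding D moment_map_heis_scaled by (simp add: scaleR_sum_right a_def)
  then have gt: "heis_diag n e d $ i $ i > ?W $ i $ i" for i
    using E by (simp add: pos_diag_ops_def)
  have "a k \<ge> 0" for k using r by (simp add: a_def sum_nonneg)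
  moreover have "d k + a k > 0" if "k \<in> {1..n}" for k
    using gt[of "e (2*k-1)"] unfolding heis_weight_sum_nth(2)[OF that] heis_diag_nth(2)[OF that] by simp
  moreover have "d (n+1) - d k + a k > 0" if "k \<in> {1..n}" for k
    using gt[of "e (2*k)"] unfolding heis_weight_sum_nth(3)[OF that] heis_diag_nth(3)[OF that] by simp
  moreover have "(\<Sum>k=1..n. a k) < d (n+1)"
    using gt[of "e (2*n+1)"] unfolding heis_weight_sum_nth(1) heis_diag_nth(1) by simp
  ultimately show ?R by blast
next
  assume ?R
  then obtain a where a: "\<forall>k\<in>{1..n}. a k \<ge> 0 \<and> d k + a k > 0 \<and> d (n+1) - d k + a k > 0"
    and sum: "(\<Sum>k=1..n. a k) < d (n+1)" by blast
  let ?W = "\<Sum>k=1..n. a k *\<^sub>R heis_weight n e k"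
  let ?E = "heis_diag n e d - ?W"
  \<comment> \<open>Square roots, because the moment map weights its summands by
    \<open>(c k)\<^sup>2\<close>.\<close>
  let ?c = "\<lambda>k. sqrt (a k)"
  \<comment> \<open>The total mass undoes the normalization. If it is 0, the moment map vanishes,
    and 1 serves as a positive factor.\<close>
  define r where "r = (if (\<Sum>k=1..n. a k) = 0 then 1 else (\<Sum>k=1..n. a k))"
  have nonneg: "(\<Sum>k=1..n. a k) \<ge> 0" using a by (intro sum_nonneg) auto
  have r: "r > 0" using nonneg by (auto simp: r_def)
  have sq: "(\<Sum>k=1..n. (?c k)\<^sup>2) = (\<Sum>k=1..n. a k)"
    "(\<Sum>k=1..n. (?c k)\<^sup>2 *\<^sub>R heis_weight n e k) = ?W"
    using a by (auto intro!: sum.cong)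
  have zero: "?W = 0" if "(\<Sum>k=1..n. a k) = 0"
  proof -
    have "\<forall>k\<in>{1..n}. a k = 0"
      using that a by (subst (asm) sum_nonneg_eq_0_iff) auto
    then show ?thesis by (intro sum.neutral) simp
  qed
  have W: "r *\<^sub>R moment_map (heis_scaled n e ?c) = ?W"
    unfolding moment_map_heis_scaled sq using zero by (simp add: r_def)
  have "moment_map (heis_scaled n e ?c) = (1 / r) *\<^sub>R ?W"
    unfolding W[symmetric] using r by simp
  then have diag: "moment_map (heis_scaled n e ?c) \<in> diag_ops"
    using heis_weight_sum_nth(4)[of a] by (simp add: diag_ops_def)
  have Ed: "?E \<in> diag_ops"
    using heis_weight_sum_nth(4)[of a] heis_diag_in_torus[of d] heis_torus_diag by (auto simp: diag_ops_def)
  have nth: "?E $ i $ i = heis_diag n e d $ i $ i - ?W $ i $ i" for i by simp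
  have "?E $ i $ i > 0" for i
  proof (cases i rule: basis_cases)
    case 1
    then show ?thesis using sum by (simp only: nth heis_weight_sum_nth heis_diag_nth)
  next
    case (2 k)
    then show ?thesis
      using a unfolding nth 2(2) heis_weight_sum_nth(2)[OF 2(1)] heis_diag_nth(2)[OF 2(1)] by simp
  next
    case (3 k)
    then show ?thesis
      using a unfolding nth 3(2) heis_weight_sum_nth(3)[OF 3(1)] heis_diag_nth(3)[OF 3(1)] by simp
  qed
  with Ed have E: "?E \<in> pos_diag_ops" by (simp add: pos_diag_ops_def)
  have "trace (heis_diag n e d) > 0"
    using nonneg sum by (simp add: trace_heis_diag)
  moreover have "heis_scaled n e ?c \<in> orbit_closure (heis_bracket n e) (heis_torus n e)"
    unfolding orbit_closure_heis using a by force
  moreover have "heis_diag n e d = r *\<^sub>R moment_map (heis_scaled n e ?c) + ?E" unfolding W by simp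
  ultimately show ?L
    unfolding cone_C_def using heis_diag_in_torus r E diag by blast
qed

end

theorem proposition1p3:
  fixes n :: nat
    and e :: "nat \<Rightarrow> 'i::{finite,linorder}"
  assumes "n \<ge> 1"
    and "bij_betw e {1..2*n+1} (UNIV :: 'i set)"
  shows "card (heis_forms n) = 3 ^ n \<and>
    (\<forall>d :: nat \<Rightarrow> real.
       heis_diag n e d \<in> cone_C (heis_bracket n e) (heis_torus n e) \<longleftrightarrow>
       (\<forall>f \<in> heis_forms n. f d > 0))"
  using card_heis_forms heis_diag_in_cone_iff[OF assms(2)] heis_forms_pos_iff by blast

end
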